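(* Let $p_n\in[0,1]$ be such that $\lim_{n\to\infty}n p_n/\ln n=0$ (supercritical regime). Let $f_{n,1}^\downarrow$ be the size (number of vertices) of the largest fireproof subtree after the fire dynamics with parameter $p_n$ on a random recursive tree $\mathsf{T}_n$ with $n$ vertices. Then $$n^{-1}f_{n,1}^\downarrow\longrightarrow1\quad\text{in probability as } n\to\infty.$$
   Context: Write $[n]=\{1,\dots,n\}$. A tree on the vertex set $[n]$ is called recursive if, when rooted at $1$, the sequence of vertices along any branch from the root to a leaf is increasing. There are $(n-1)!$ such trees; the random recursive tree $\mathsf{T}_n$ is one of them picked uniformly at random. Fire dynamics with parameter $p_n$ on a tree with $n$ vertices: initially every edge is flammable. The edges are considered successively in a uniform random order; an edge which has already burnt is not subject to the dynamics any more and is skipped. Otherwise, independently of everything else, the edge becomes fireproof with probability $1-p_n$ or is set on fire with probability $p_n$; in the latter case the edge burns, sets on fire its flammable neighbouring edges, and the fire propagates instantly, stopped only by fireproof edges (so that the whole connected set of flammable edges containing it burns). The dynamics continue until all edges are either burnt or fireproof. A vertex is called fireproof if all its adjacent edges are fireproof, and burnt otherwise. The fireproof edges with at least one burnt extremity are then discarded; the connected components of the resulting forest are either composed of fireproof vertices (the fireproof subtrees) or of burnt vertices (the burnt subtrees). The size of the largest fireproof subtree is $0$ if there is no fireproof vertex. *)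

theory Defs
  imports
    "HOL-Probability.Probability"
    "HOL-Combinatorics.Multiset_Permutations"
begin

text \<open>
  A simple graph is given by a vertex set and a set of two-element edges.
\<close>

definition adj :: "'a set set \<Rightarrow> 'a rel" where
  "adj E = {(u, v). {u, v} \<in> E}"

definition components :: "'a set \<Rightarrow> 'a set set \<Rightarrow> 'a set set" where
  "components V E = V // (adj E)\<^sup>*"

definition is_path :: "'a set \<Rightarrow> 'a set set \<Rightarrow> 'a list \<Rightarrow> bool" where
  "is_path V E xs \<longleftrightarrow>
     xs \<noteq> [] \<and> set xs \<subseteq> V \<and> distinct xs \<and> successively (\<lambda>u v. {u, v} \<in> E) xs"

definition is_cycle :: "'a set \<Rightarrow> 'a set set \<Rightarrow> 'a list \<Rightarrow> bool" where
  "is_cycle V E xs \<longleftrightarrow> is_path V E xs \<and> length xs \<ge> 3 \<and> {last xs, hd xs} \<in> E"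

definition is_tree :: "'a set \<Rightarrow> 'a set set \<Rightarrow> bool" where
  "is_tree V E \<longleftrightarrow>
     E \<subseteq> {e. e \<subseteq> V \<and> card e = 2} \<and>
     (\<forall>u\<in>V. \<forall>v\<in>V. (u, v) \<in> (adj E)\<^sup>*) \<and>
     (\<nexists>xs. is_cycle V E xs)"

text \<open>A root of degree one does not count as a leaf.\<close>

definition is_leaf :: "'a \<Rightarrow> 'a set \<Rightarrow> 'a set set \<Rightarrow> 'a \<Rightarrow> bool" where
  "is_leaf r V E v \<longleftrightarrow> v \<in> V \<and> v \<noteq> r \<and> card {e \<in> E. v \<in> e} = 1"

definition is_branch :: "'a \<Rightarrow> 'a set \<Rightarrow> 'a set set \<Rightarrow> 'a list \<Rightarrow> bool" where
  "is_branch r V E xs \<longleftrightarrow> is_path V E xs \<and> hd xs = r \<and> is_leaf r V E (last xs)"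

definition recursive_trees :: "nat \<Rightarrow> nat set set set" where
  "recursive_trees n =
     {E. is_tree {1..n} E \<and> (\<forall>xs. is_branch 1 {1..n} E xs \<longrightarrow> sorted_wrt (<) xs)}"

text \<open>
  The edges burnt when \<^term>\<open>e\<close> is set on fire: those joined to \<^term>\<open>e\<close> by a chain of
  flammable edges, consecutive ones sharing an endpoint.
\<close>

definition fire_cluster :: "'a set set \<Rightarrow> 'a set \<Rightarrow> 'a set set" where
  "fire_cluster Flammable e =
     {(a, b). a \<in> Flammable \<and> b \<in> Flammable \<and> a \<inter> b \<noteq> {}}\<^sup>* `` {e}"

text \<open>
  The list contains the edges still to be considered, in order; \<^term>\<open>F\<close> and \<^term>\<open>B\<close> are
  the edges that are already fireproof and already burnt. The outcome is the final set of
  fireproof edges, all others being burnt. A Bernoulli outcome \<^term>\<open>True\<close> (probability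
  \<^term>\<open>p\<close>) sets the edge on fire.
\<close>

fun fire_run :: "real \<Rightarrow> 'a set set \<Rightarrow> 'a set list \<Rightarrow> 'a set set \<Rightarrow> 'a set set \<Rightarrow> 'a set set pmf"
where
  "fire_run p E [] F B = return_pmf F"
| "fire_run p E (e # es) F B =
     (if e \<in> B then fire_run p E es F B
      else bind_pmf (bernoulli_pmf p)
        (\<lambda>on_fire. if on_fire
           then fire_run p E es F (B \<union> fire_cluster (E - F - B) e)
           else fire_run p E es (insert e F) B))"

definition fire_dynamics :: "real \<Rightarrow> 'a set set \<Rightarrow> 'a set set pmf" where
  "fire_dynamics p E =
     bind_pmf (pmf_of_set (permutations_of_set E)) (\<lambda>es. fire_run p E es {} {})"

definition fireproof_vertices :: "'a set \<Rightarrow> 'a set set \<Rightarrow> 'a set set \<Rightarrow> 'a set" where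
  "fireproof_vertices V E F = {v \<in> V. \<forall>e\<in>E. v \<in> e \<longrightarrow> e \<in> F}"

definition remaining_edges :: "'a set \<Rightarrow> 'a set set \<Rightarrow> 'a set set \<Rightarrow> 'a set set" where
  "remaining_edges V E F = E - {e \<in> F. \<exists>v\<in>e. v \<notin> fireproof_vertices V E F}"

definition fireproof_subtrees :: "'a set \<Rightarrow> 'a set set \<Rightarrow> 'a set set \<Rightarrow> 'a set set" where
  "fireproof_subtrees V E F =
     {C \<in> components V (remaining_edges V E F). C \<subseteq> fireproof_vertices V E F}"

definition largest_fireproof :: "'a set \<Rightarrow> 'a set set \<Rightarrow> 'a set set \<Rightarrow> nat" where
  "largest_fireproof V E F = Max (insert 0 (card ` fireproof_subtrees V E F))"

text \<open>The law of the size of the largest fireproof subtree of a random recursive tree.\<close>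

definition largest_fireproof_pmf :: "nat \<Rightarrow> real \<Rightarrow> nat pmf" where
  "largest_fireproof_pmf n p =
     do {
       E \<leftarrow> pmf_of_set (recursive_trees n);
       F \<leftarrow> fire_dynamics p E;
       return_pmf (largest_fireproof {1..n} E F)
     }"

end

(*
  A recursive tree is a map f with f k < k (the parent of k). The fireproof component of the
  root contains every v all of whose ancestors are fireproof. A fire lit at the edge above w
  reaches an ancestor of v only if this edge comes first among the edges joining w to the
  ancestors of v; if there are D of them, this happens with probability 1/D. So v is cut off
  from the root with probability at most p times the sum over w of 1/max 1 D. Averaging over
  trees, the sum S n over v, w <= n of (1/2)^D satisfies S (n+1) = (1 + 3/(2n)) S n + 1, hence
  is O(n^(3/2)); so D is at least a multiple of ln n for most pairs (v, w) and the expected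
  number of vertices cut off is O(p n^2 / ln n) = o(n). Markov's inequality concludes.
*)
theory Submission
  imports Defs "HOL-Real_Asymp.Real_Asymp"
begin

subsection \<open>Burning probabilities\<close>

lemma prob_bind_pmf:
  "measure_pmf.prob (bind_pmf M g) X = measure_pmf.expectation M (\<lambda>a. measure_pmf.prob (g a) X)"
  unfolding measure_pmf_bind
  by (intro measure_pmf.measure_bind[where N = "count_space UNIV"]) (auto simp: measure_subprob)

lemma prob_bind_bernoulli_pmf:
  assumes "0 \<le> p" "p \<le> 1"
  shows "measure_pmf.prob (bind_pmf (bernoulli_pmf p) g) X =
    p * measure_pmf.prob (g True) X + (1 - p) * measure_pmf.prob (g False) X"
  using assms by (simp add: prob_bind_pmf mult.commute)

lemma prob_bind_pmf_of_set:
  assumes "finite A" "A \<noteq> {}"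
  shows "measure_pmf.prob (bind_pmf (pmf_of_set A) g) X =
    (\<Sum>a\<in>A. measure_pmf.prob (g a) X) / real (card A)"
  using assms by (simp add: prob_bind_pmf integral_pmf_of_set)

text \<open>The suffix from \<open>e\<close> on is what remains to be considered when
  \<open>e\<close> has its turn, so this condition can be checked along
  \<open>fire_run\<close>.\<close>

definition precedes_all :: "'a \<Rightarrow> 'a set \<Rightarrow> 'a list \<Rightarrow> bool" where
  "precedes_all e S es \<longleftrightarrow> (\<exists>ys zs. es = ys @ e # zs \<and> S \<subseteq> set (e # zs))"

lemma precedes_all_Cons: "precedes_all e S es \<Longrightarrow> precedes_all e S (x # es)"
  unfolding precedes_all_def by (metis append_Cons)

text \<open>Expresses the event through one function of the list, so that the events for different
  elements of \<open>S\<close> are disjoint.\<close>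

lemma hd_filter_eq_if_precedes_all:
  assumes "precedes_all e S es" "distinct es" "e \<in> S"
  shows "hd (filter (\<lambda>x. x \<in> S) es) = e"
proof -
  obtain ys zs where es: "es = ys @ e # zs" and S: "S \<subseteq> set (e # zs)"
    using assms(1) unfolding precedes_all_def by blast
  have "filter (\<lambda>x. x \<in> S) ys = []"
    using es S assms(2) by (auto simp: filter_empty_conv)
  then show ?thesis
    using es assms(3) by simp
qed

text \<open>By symmetry: exchanging \<open>e\<close> and \<open>x\<close> injects the orders in
  which \<open>e\<close> comes first in \<open>S\<close> into those in which \<open>x\<close> does,
  and these \<open>card S\<close> classes are disjoint.\<close>

lemma card_permutations_precedes_all:
  assumes "finite A" "S \<subseteq> A" "e \<in> S"
  shows "real (card {es \<in> permutations_of_set A. precedes_all e S es}) \<le>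
    real (card (permutations_of_set A)) / real (card S)"
proof -
  define H where "H x = {es \<in> permutations_of_set A. hd (filter (\<lambda>y. y \<in> S) es) = x}" for x
  have fS: "finite S" using assms finite_subset by blast
  have fH: "finite (H x)" for x by (simp add: H_def)
  have le: "card (H e) \<le> card (H x)" if x: "x \<in> S" for x
  proof (rule card_inj_on_le[where f = "map (Transposition.transpose e x)"])
    show "inj_on (map (Transposition.transpose e x)) (H e)"
      by (rule inj_on_subset[OF inj_mapI]) simp_all
    show "map (Transposition.transpose e x) ` H e \<subseteq> H x"
    proof (rule image_subsetI)
      fix es assume es: "es \<in> H e"
      then have es': "set es = A" "distinct es" "hd (filter (\<lambda>y. y \<in> S) es) = e"
        by (auto simp: H_def permutations_of_set_def)
      have ne: "filter (\<lambda>y. y \<in> S) es \<noteq> []"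
        using es'(1) assms by (auto simp: filter_empty_conv)
      have iff: "Transposition.transpose e x y \<in> S \<longleftrightarrow> y \<in> S" for y
        using x assms(3) by (auto simp: Transposition.transpose_def)
      have "filter (\<lambda>y. y \<in> S) (map (Transposition.transpose e x) es) =
          map (Transposition.transpose e x) (filter (\<lambda>y. y \<in> S) es)"
        by (simp add: filter_map o_def iff)
      then have "hd (filter (\<lambda>y. y \<in> S) (map (Transposition.transpose e x) es)) = x"
        using ne es'(3) by (simp add: hd_map)
      moreover have "Transposition.transpose e x ` A = A"
        using x assms by (intro transpose_image_eq) auto
      ultimately show "map (Transposition.transpose e x) es \<in> H x"
        using es' by (simp add: H_def permutations_of_set_def distinct_map)
    qed
  qed (rule fH)
  have "card S * card (H e) \<le> (\<Sum>x\<in>S. card (H x))"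
    using sum_mono[of S "\<lambda>_. card (H e)", OF le] by simp
  also have "\<dots> = card (\<Union>x\<in>S. H x)"
    by (rule card_UN_disjoint[symmetric]) (use fS fH in \<open>auto simp: H_def\<close>)
  also have "\<dots> \<le> card (permutations_of_set A)"
    by (rule card_mono) (auto simp: H_def)
  finally have "real (card S) * real (card (H e)) \<le> real (card (permutations_of_set A))"
    by (metis of_nat_le_iff of_nat_mult)
  moreover have "card {es \<in> permutations_of_set A. precedes_all e S es} \<le> card (H e)"
    by (rule card_mono[OF fH])
      (auto simp: H_def permutations_of_set_def intro!: hd_filter_eq_if_precedes_all assms)
  moreover have "card S > 0" using fS assms(3) by (auto simp: card_gt_0_iff)
  ultimately show ?thesis
    by (smt (verit) mult.commute of_nat_0_less_iff of_nat_le_iff pos_le_divide_eq)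
qed

section \<open>Fires reaching a given vertex set\<close>

lemma fire_cluster_mono: "A \<subseteq> A' \<Longrightarrow> fire_cluster A e \<subseteq> fire_cluster A' e"
  unfolding fire_cluster_def by (intro Image_mono rtrancl_mono) auto

lemma self_in_fire_cluster: "e \<in> fire_cluster A e"
  unfolding fire_cluster_def by auto

text \<open>Union bound over the edge whose fire first reaches \<open>P\<close>. By
  \<open>sep\<close>, when such a fire is lit at \<open>e\<close>, all of \<open>S e\<close> is
  still in the list, so it can be charged to the term of \<open>e\<close>, with probability
  \<open>p\<close>. The last two premises are invariants: every edge neither fireproof nor burnt is
  still in the list, and no burnt edge touches \<open>P\<close>.\<close>

lemma prob_fire_run_touches_le:
  fixes E :: "'a set set" and P :: "'a set"
  assumes p: "0 \<le> p" "p \<le> 1"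
    and sep: "\<And>A e. \<lbrakk>e \<in> A; A \<subseteq> E; \<exists>a\<in>fire_cluster A e. a \<inter> P \<noteq> {}\<rbrakk> \<Longrightarrow> S e \<subseteq> A"
    and "distinct es" "set es \<subseteq> E" "E - F - B \<subseteq> set es" "\<forall>b\<in>B. b \<inter> P = {}"
  shows "measure_pmf.prob (fire_run p E es F B) {F'. \<exists>e\<in>E. e \<inter> P \<noteq> {} \<and> e \<notin> F'} \<le>
    p * (\<Sum>e\<in>set es. of_bool (precedes_all e (S e) es))"
  using assms(4-)
proof (induction es arbitrary: F B)
  case Nil
  then have "E - F \<subseteq> B" by auto
  with Nil have "F \<notin> {F'. \<exists>e\<in>E. e \<inter> P \<noteq> {} \<and> e \<notin> F'}" by auto
  then show ?case by (simp add: indicator_def)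
next
  case (Cons e es)
  let ?X = "{F'. \<exists>e\<in>E. e \<inter> P \<noteq> {} \<and> e \<notin> F'}"
  let ?s = "\<lambda>es. \<Sum>e\<in>set es. of_bool (precedes_all e (S e) es) :: real"
  let ?C = "fire_cluster (E - F - B) e"
  have e: "e \<notin> set es" "e \<in> E" using Cons.prems by auto
  have "?s es \<le> (\<Sum>x\<in>set es. of_bool (precedes_all x (S x) (e # es)))"
    by (intro sum_mono) (simp add: precedes_all_Cons)
  then have s: "of_bool (precedes_all e (S e) (e # es)) + ?s es \<le> ?s (e # es)"
    using e by (simp del: sum_of_bool_eq)
  then have s0: "?s es \<le> ?s (e # es)"
    by (rule order_trans[rotated]) simp
  have "distinct es" using Cons.prems(1) by simp
  note IH = Cons.IH[OF this]
  show ?case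
  proof (cases "e \<in> B")
    case True
    then have "measure_pmf.prob (fire_run p E es F B) ?X \<le> p * ?s es"
      using Cons.prems by (intro IH) auto
    also have "\<dots> \<le> p * ?s (e # es)" using s0 p by (intro mult_left_mono)
    finally show ?thesis using True by simp
  next
    case False
    let ?x = "measure_pmf.prob (fire_run p E es F (B \<union> ?C)) ?X"
    let ?y = "measure_pmf.prob (fire_run p E es (insert e F) B) ?X"
    have eq: "measure_pmf.prob (fire_run p E (e # es) F B) ?X = p * ?x + (1 - p) * ?y"
      using False p by (simp add: prob_bind_bernoulli_pmf)
    have y: "?y \<le> p * ?s es"
      using Cons.prems by (intro IH) auto
    have "p * ?x + (1 - p) * ?y \<le> p * ?s (e # es)"
    proof (cases "\<exists>a\<in>?C. a \<inter> P \<noteq> {}")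
      case True
      \<comment> \<open>All flammable edges are still in the list, so \<open>sep\<close> may be
        applied to the list in place of the flammable set.\<close>
      then have "\<exists>a\<in>fire_cluster (set (e # es)) e. a \<inter> P \<noteq> {}"
        using fire_cluster_mono[OF Cons.prems(3)] by blast
      then have "S e \<subseteq> set (e # es)"
        using Cons.prems(2) by (intro sep[of e]) simp_all
      then have "precedes_all e (S e) (e # es)"
        unfolding precedes_all_def by (intro exI[of _ "[]"] exI[of _ es]) simp
      then have "1 + ?s es \<le> ?s (e # es)" using s by simp
      \<comment> \<open>The term of \<open>e\<close> equals 1 here and pays for the fire, whatever
        happens afterwards.\<close>
      then have "p * (1 + ?s es) \<le> p * ?s (e # es)" using p by (intro mult_left_mono)
      moreover have "p * ?x \<le> p * 1" using p by (intro mult_left_mono) auto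
      moreover have "(1 - p) * ?y \<le> 1 * ?y" using p by (intro mult_right_mono) auto
      ultimately show ?thesis using y by (simp add: algebra_simps)
    next
      case False
      \<comment> \<open>This fire misses \<open>P\<close>, so the invariants persist and both
        branches obey the bound for \<open>es\<close>.\<close>
      have "?x \<le> p * ?s es"
      proof (rule IH)
        show "E - F - (B \<union> ?C) \<subseteq> set es"
          using Cons.prems(3) self_in_fire_cluster[of e "E - F - B"] by auto
      qed (use Cons.prems False in auto)
      then have "p * ?x + (1 - p) * ?y \<le> p * (p * ?s es) + (1 - p) * (p * ?s es)"
        using y p by (intro add_mono mult_left_mono) auto
      also have "\<dots> = p * ?s es" by (simp add: algebra_simps)
      also have "\<dots> \<le> p * ?s (e # es)" using s0 p by (intro mult_left_mono)
      finally show ?thesis .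
    qed
    then show ?thesis using eq by linarith
  qed
qed

text \<open>Averaging over the order turns each indicator into the probability that \<open>e\<close>
  comes first in \<open>S e\<close>.\<close>

lemma prob_fire_dynamics_touches_le:
  fixes E :: "'a set set" and P :: "'a set"
  assumes p: "0 \<le> p" "p \<le> 1" and E: "finite E"
    and S: "\<And>e. e \<in> E \<Longrightarrow> e \<in> S e \<and> S e \<subseteq> E"
    and sep: "\<And>A e. \<lbrakk>e \<in> A; A \<subseteq> E; \<exists>a\<in>fire_cluster A e. a \<inter> P \<noteq> {}\<rbrakk> \<Longrightarrow> S e \<subseteq> A"
  shows "measure_pmf.prob (fire_dynamics p E) {F. \<exists>e\<in>E. e \<inter> P \<noteq> {} \<and> e \<notin> F} \<le>
    p * (\<Sum>e\<in>E. 1 / real (card (S e)))"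
proof -
  let ?\<Pi> = "permutations_of_set E"
  let ?X = "{F. \<exists>e\<in>E. e \<inter> P \<noteq> {} \<and> e \<notin> F}"
  have ne: "?\<Pi> \<noteq> {}" using E by simp
  then have c: "real (card ?\<Pi>) > 0" by (simp add: card_gt_0_iff)
  have "measure_pmf.prob (fire_dynamics p E) ?X =
      (\<Sum>es\<in>?\<Pi>. measure_pmf.prob (fire_run p E es {} {}) ?X) / card ?\<Pi>"
    unfolding fire_dynamics_def using E by (intro prob_bind_pmf_of_set) auto
  also have "(\<Sum>es\<in>?\<Pi>. measure_pmf.prob (fire_run p E es {} {}) ?X) \<le>
      (\<Sum>es\<in>?\<Pi>. p * (\<Sum>e\<in>E. of_bool (precedes_all e (S e) es)))"
  proof (rule sum_mono)
    fix es assume "es \<in> ?\<Pi>"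
    then have es: "set es = E" "distinct es" by (auto simp: permutations_of_set_def)
    then have "measure_pmf.prob (fire_run p E es {} {}) ?X \<le>
        p * (\<Sum>e\<in>set es. of_bool (precedes_all e (S e) es))"
      by (intro prob_fire_run_touches_le p sep) auto
    then show "measure_pmf.prob (fire_run p E es {} {}) ?X \<le>
        p * (\<Sum>e\<in>E. of_bool (precedes_all e (S e) es))"
      using es(1) by simp
  qed
  also have "\<dots> = p * (\<Sum>e\<in>E. \<Sum>es\<in>?\<Pi>. of_bool (precedes_all e (S e) es))"
    by (subst sum.swap) (simp add: sum_distrib_left[symmetric])
  also have "\<dots> = p * (\<Sum>e\<in>E. real (card {es \<in> ?\<Pi>. precedes_all e (S e) es}))"
    by (simp add: of_nat_sum[symmetric] sum_of_bool_eq Int_def del: of_nat_sum)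
  also have "\<dots> \<le> p * (\<Sum>e\<in>E. real (card ?\<Pi>) / real (card (S e)))"
    using E p S by (intro mult_left_mono sum_mono card_permutations_precedes_all) auto
  also have "\<dots> = real (card ?\<Pi>) * (p * (\<Sum>e\<in>E. 1 / real (card (S e))))"
    by (simp add: sum_distrib_left mult_ac)
  finally show ?thesis
    using c E by (simp add: divide_right_mono field_simps)
qed

subsection \<open>Fire on a tree given by its parent map\<close>

text \<open>Vertex \<open>1\<close> is the root, and every other vertex chooses a smaller parent.
  The extensional product fixes the values outside \<open>{2..n}\<close>, so that the tree
  determines the map.\<close>

definition parent_maps :: "nat \<Rightarrow> (nat \<Rightarrow> nat) set" where
  "parent_maps n = (\<Pi>\<^sub>E k\<in>{2..n}. {1..<k})"

definition parent_edges :: "nat \<Rightarrow> (nat \<Rightarrow> nat) \<Rightarrow> nat set set" where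
  "parent_edges n f = (\<lambda>k. {k, f k}) ` {2..n}"

text \<open>The guard \<open>f k < k\<close> ensures termination for arbitrary maps; on
  \<open>parent_maps n\<close> it holds at every vertex of \<open>{2..n}\<close>.\<close>

function ancestors :: "(nat \<Rightarrow> nat) \<Rightarrow> nat \<Rightarrow> nat set" where
  "ancestors f k = (if 2 \<le> k \<and> f k < k then insert k (ancestors f (f k)) else {k})"
  by auto
termination by (relation "Wellfounded.measure snd") auto

declare ancestors.simps [simp del]

lemma parent_maps_bounds:
  "f \<in> parent_maps n \<Longrightarrow> 2 \<le> k \<Longrightarrow> k \<le> n \<Longrightarrow> 1 \<le> f k \<and> f k < k"
  unfolding parent_maps_def by (drule PiE_mem[of _ _ _ k]) auto

lemma finite_parent_maps: "finite (parent_maps n)"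
  unfolding parent_maps_def by (intro finite_PiE) auto

lemma parent_maps_nonempty: "parent_maps n \<noteq> {}"
  unfolding parent_maps_def by (auto simp: PiE_eq_empty_iff)

lemma ancestors_unfold:
  "f \<in> parent_maps n \<Longrightarrow> 2 \<le> k \<Longrightarrow> k \<le> n \<Longrightarrow> ancestors f k = insert k (ancestors f (f k))"
  using parent_maps_bounds[of f n k] by (subst ancestors.simps) simp

lemma ancestors_1: "ancestors f (Suc 0) = {1}"
  by (subst ancestors.simps) simp

lemma self_in_ancestors: "k \<in> ancestors f k"
  by (subst ancestors.simps) simp

text \<open>Used when a new largest vertex is attached: the ancestors of the older vertices do not
  change.\<close>

lemma ancestors_cong:
  "(\<And>j. j \<le> k \<Longrightarrow> f j = g j) \<Longrightarrow> ancestors f k = ancestors g k"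
proof (induction k rule: less_induct)
  case (less k)
  show ?case
  proof (cases "2 \<le> k \<and> f k < k")
    case True
    then have "ancestors f (f k) = ancestors g (f k)"
      using less by (intro less.IH) auto
    then show ?thesis
      using less.prems[of k] by (auto simp: ancestors.simps[of f k] ancestors.simps[of g k])
  next
    case False
    then show ?thesis
      using less.prems[of k] by (auto simp: ancestors.simps[of f k] ancestors.simps[of g k])
  qed
qed

lemma parent_map_induct [consumes 2, case_names root child]:
  assumes "f \<in> parent_maps n" "k \<in> {1..n}" "P 1"
    and "\<And>k. \<lbrakk>2 \<le> k; k \<le> n; 1 \<le> f k; f k < k; P (f k)\<rbrakk> \<Longrightarrow> P k"
  shows "P k"
  using assms(2)
proof (induction k rule: less_induct)
  case (less k)
  show ?case
  proof (cases "k = 1")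
    case False
    then have k: "2 \<le> k" "k \<le> n" using less.prems by auto
    then show ?thesis
      using parent_maps_bounds[OF assms(1) k] less.IH[of "f k"] by (auto intro!: assms(4)[of k])
  qed (use assms(3) in simp)
qed

lemma ancestors_subset:
  assumes f: "f \<in> parent_maps n" and k: "k \<in> {1..n}"
  shows "ancestors f k \<subseteq> {1..k}"
  using assms
proof (induction k rule: parent_map_induct)
  case root
  show ?case by (simp add: ancestors_1)
next
  case (child k)
  then show ?case using ancestors_unfold[OF f, of k] by fastforce
qed

lemma root_in_ancestors:
  assumes f: "f \<in> parent_maps n" and k: "k \<in> {1..n}"
  shows "1 \<in> ancestors f k"
  using assms
proof (induction k rule: parent_map_induct)
  case root
  show ?case by (simp add: ancestors_1)
next
  case (child k)
  then show ?case using ancestors_unfold[OF f, of k] by simp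
qed

lemma finite_ancestors: "f \<in> parent_maps n \<Longrightarrow> k \<in> {1..n} \<Longrightarrow> finite (ancestors f k)"
  by (rule finite_subset[OF ancestors_subset[of f n k]]) simp_all

lemma ancestors_trans:
  assumes f: "f \<in> parent_maps n" and k: "k \<in> {1..n}" and u: "u \<in> ancestors f k"
  shows "ancestors f u \<subseteq> ancestors f k"
  using f k u
proof (induction k rule: parent_map_induct)
  case root
  then show ?case by (simp add: ancestors_1)
next
  case (child k)
  then show ?case using ancestors_unfold[OF f, of k] by auto
qed

lemma Max_parent_edge:
  "f \<in> parent_maps n \<Longrightarrow> k \<in> {2..n} \<Longrightarrow> Max {k, f k} = k"
  using parent_maps_bounds[of f n k] by (simp add: max_def)

lemma inj_on_parent_edge: "f \<in> parent_maps n \<Longrightarrow> inj_on (\<lambda>k. {k, f k}) {2..n}"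
  by (rule inj_on_inverseI[of _ Max]) (rule Max_parent_edge)

text \<open>
  If the parent edge of \<^term>\<open>u\<close> is missing from \<^term>\<open>A\<close>, a fire started below
  \<^term>\<open>u\<close> stays below \<^term>\<open>u\<close>.
\<close>

lemma fire_cluster_below:
  assumes f: "f \<in> parent_maps n" and A: "A \<subseteq> parent_edges n f"
    and w: "w \<in> {2..n}" "{w, f w} \<in> A" and u: "u \<in> ancestors f w" "{u, f u} \<notin> A"
    and a: "a \<in> fire_cluster A {w, f w}" "x \<in> a"
  shows "u \<in> ancestors f x"
proof -
  \<comment> \<open>An edge other than the one above \<open>u\<close> has both endpoints below
    \<open>u\<close> or neither.\<close>
  have up: "u \<in> ancestors f y"
    if k: "k \<in> {2..n}" "{k, f k} \<in> A" "z \<in> {k, f k}" "y \<in> {k, f k}" "u \<in> ancestors f z" for k y z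
  proof -
    have "ancestors f k = insert k (ancestors f (f k))" "k \<noteq> u"
      using k u by (auto intro!: ancestors_unfold[OF f])
    then show ?thesis using k by auto
  qed
  have "({w, f w}, a) \<in> {(a, b). a \<in> A \<and> b \<in> A \<and> a \<inter> b \<noteq> {}}\<^sup>*"
    using a unfolding fire_cluster_def by simp
  then have "\<forall>x\<in>a. u \<in> ancestors f x"
  proof (induction rule: rtrancl_induct)
    case base
    then show ?case using up[OF w, of w] u by blast
  next
    case (step a b)
    then obtain k z where "k \<in> {2..n}" "b = {k, f k}" "b \<in> A" "z \<in> b" "u \<in> ancestors f z"
      using A unfolding parent_edges_def by blast
    then show ?case using up by blast
  qed
  then show ?thesis using a by blast
qed

text \<open>Times \<open>p\<close>, this bounds the expected number of vertices \<open>v\<close>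
  with an ancestor that is not fireproof. The \<open>max 1\<close> covers the case that
  \<open>w\<close> is an ancestor of \<open>v\<close>: the difference is then empty.\<close>

definition burn_bound :: "nat \<Rightarrow> (nat \<Rightarrow> nat) \<Rightarrow> real" where
  "burn_bound n f = (\<Sum>v\<in>{1..n}. \<Sum>w\<in>{1..n}.
     1 / max 1 (real (card (ancestors f w - ancestors f v))))"

text \<open>A fire lit above \<open>w\<close> has to climb through the ancestors of \<open>w\<close>
  that are not ancestors of \<open>v\<close>; their parent edges form \<open>S e\<close>.\<close>

lemma prob_ancestors_burnt_le:
  assumes p: "0 \<le> p" "p \<le> 1" and f: "f \<in> parent_maps n" and v: "v \<in> {1..n}"
  defines "E \<equiv> parent_edges n f"
  shows "measure_pmf.prob (fire_dynamics p E)
      {F. \<not> ancestors f v \<subseteq> fireproof_vertices {1..n} E F} \<le>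
    p * (\<Sum>w\<in>{1..n}. 1 / max 1 (real (card (ancestors f w - ancestors f v))))"
proof -
  let ?P = "ancestors f v"
  \<comment> \<open>Inserting \<open>w\<close> puts \<open>e\<close> into \<open>S e\<close> even if
    \<open>w\<close> is an ancestor of \<open>v\<close>; this is the source of \<open>max 1\<close>
    in \<open>card_S\<close>.\<close>
  let ?K = "\<lambda>w. insert w (ancestors f w - ?P)"
  define S where "S e = (\<lambda>k. {k, f k}) ` ?K (Max e)" for e :: "nat set"
  have K: "?K w \<subseteq> {2..n}" if "w \<in> {2..n}" for w
  proof
    fix x assume x: "x \<in> ?K w"
    then have "x \<in> {1..w}" using ancestors_subset[OF f, of w] that by auto
    moreover have "x \<noteq> 1" using x that root_in_ancestors[OF f v] by auto
    ultimately show "x \<in> {2..n}" using that by auto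
  qed
  have S_eq: "S {w, f w} = (\<lambda>k. {k, f k}) ` ?K w" if "w \<in> {2..n}" for w
    unfolding S_def Max_parent_edge[OF f that] ..
  have card_S: "real (card (S {w, f w})) = max 1 (real (card (ancestors f w - ?P)))"
    if w: "w \<in> {2..n}" for w
  proof -
    have "card (S {w, f w}) = card (?K w)"
      unfolding S_eq[OF w] using K[OF w] inj_on_parent_edge[OF f]
      by (intro card_image) (rule inj_on_subset)
    moreover have "real (card (?K w)) = max 1 (real (card (ancestors f w - ?P)))"
    proof (cases "w \<in> ?P")
      case True
      then have "ancestors f w - ?P = {}" using ancestors_trans[OF f v] by blast
      then show ?thesis by (simp only:) simp
    next
      case False
      then have eq: "?K w = ancestors f w - ?P" using self_in_ancestors by blast
      have "card {w} \<le> card (?K w)"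
        using finite_ancestors[OF f, of w] w by (intro card_mono) auto
      then show ?thesis unfolding eq by simp
    qed
    ultimately show ?thesis by simp
  qed
  have "ancestors f v \<subseteq> {1..n}" using ancestors_subset[OF f v] v by fastforce
  then have "measure_pmf.prob (fire_dynamics p E)
      {F. \<not> ancestors f v \<subseteq> fireproof_vertices {1..n} E F} =
    measure_pmf.prob (fire_dynamics p E) {F. \<exists>e\<in>E. e \<inter> ?P \<noteq> {} \<and> e \<notin> F}"
    by (intro arg_cong[where f = "measure_pmf.prob _"]) (auto simp: fireproof_vertices_def)
  also have "\<dots> \<le> p * (\<Sum>e\<in>E. 1 / real (card (S e)))"
  proof (rule prob_fire_dynamics_touches_le[OF p])
    show "finite E" by (simp add: E_def parent_edges_def)
    show "e \<in> S e \<and> S e \<subseteq> E" if "e \<in> E" for e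
    proof -
      from that obtain w where w: "w \<in> {2..n}" "e = {w, f w}"
        by (auto simp: E_def parent_edges_def)
      then show ?thesis
        using K[OF w(1)] by (auto simp: S_eq E_def parent_edges_def)
    qed
    show "S e \<subseteq> A" if A: "e \<in> A" "A \<subseteq> E" "\<exists>a\<in>fire_cluster A e. a \<inter> ?P \<noteq> {}" for A e
    proof
      fix b assume b: "b \<in> S e"
      have "e \<in> E" using A(1,2) by (rule rev_subsetD)
      then obtain w where w: "w \<in> {2..n}" "e = {w, f w}"
        by (auto simp: E_def parent_edges_def)
      from b obtain u where u: "u \<in> ?K w" "b = {u, f u}"
        unfolding w(2) S_eq[OF w(1)] by blast
      show "b \<in> A"
      \<comment> \<open>A missing edge above \<open>u\<close> would keep the fire below
        \<open>u\<close>. A vertex of \<open>?P\<close> reached by it would then have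
        \<open>u\<close> as an ancestor, forcing \<open>u\<close> into \<open>?P\<close>.\<close>
      proof (rule ccontr)
        assume nb: "b \<notin> A"
        then have u': "u \<in> ancestors f w" "u \<notin> ?P" using u w A(1) by auto
        from A(3) obtain a x where "a \<in> fire_cluster A {w, f w}" "x \<in> a" and x: "x \<in> ?P"
          unfolding w(2) by blast
        moreover have "A \<subseteq> parent_edges n f" "{w, f w} \<in> A" "{u, f u} \<notin> A"
          using A w nb u unfolding E_def by auto
        ultimately have "u \<in> ancestors f x"
          using fire_cluster_below[OF f _ w(1)] u'(1) by blast
        then have "u \<in> ?P" using ancestors_trans[OF f v x] by blast
        then show False using u' by simp
      qed
    qed
  qed
  also have "(\<Sum>e\<in>E. 1 / real (card (S e))) =
      (\<Sum>w\<in>{2..n}. 1 / max 1 (real (card (ancestors f w - ?P))))"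
    unfolding E_def parent_edges_def
    by (subst sum.reindex[OF inj_on_parent_edge[OF f]]) (auto simp: card_S)
  \<comment> \<open>The root has no parent edge; adding its term lets \<open>v\<close> and
    \<open>w\<close> range over the same set.\<close>
  also have "p * \<dots> \<le> p * (\<Sum>w\<in>{1..n}. 1 / max 1 (real (card (ancestors f w - ?P))))"
    using p by (intro mult_left_mono sum_mono2) auto
  finally show ?thesis .
qed

section \<open>The root component and Markov's inequality\<close>

lemma parent_edges_subset:
  assumes "f \<in> parent_maps n"
  shows "parent_edges n f \<subseteq> {e. e \<subseteq> {1..n} \<and> card e = 2}"
proof -
  have "{k, f k} \<subseteq> {1..n} \<and> card {k, f k} = 2" if "k \<in> {2..n}" for k
    using parent_maps_bounds[OF assms, of k] that by (auto simp: card_insert_if)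
  then show ?thesis unfolding parent_edges_def by blast
qed

lemma largest_fireproof_le:
  assumes "n \<ge> 1"
  shows "largest_fireproof {1..n} E F \<le> n"
proof -
  have "card C \<le> n" if "C \<subseteq> fireproof_vertices {1..n} E F" for C
  proof -
    have "C \<subseteq> {1..n}" using that by (auto simp: fireproof_vertices_def)
    then show ?thesis using card_mono[of "{1..n}" C] by simp
  qed
  moreover have "finite (fireproof_subtrees {1..n} E F)"
    unfolding fireproof_subtrees_def components_def quotient_def by simp
  ultimately show ?thesis
    unfolding largest_fireproof_def fireproof_subtrees_def by auto
qed

text \<open>All these vertices lie in the component of the root: the edges from such a vertex up to
  the root join fireproof vertices and are not discarded.\<close>

lemma largest_fireproof_ge:
  assumes f: "f \<in> parent_maps n"
  defines "E \<equiv> parent_edges n f"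
  shows "card {v \<in> {1..n}. ancestors f v \<subseteq> fireproof_vertices {1..n} E F} \<le>
    largest_fireproof {1..n} E F"
proof (cases "{v \<in> {1..n}. ancestors f v \<subseteq> fireproof_vertices {1..n} E F} = {}")
  case False
  let ?G = "{v \<in> {1..n}. ancestors f v \<subseteq> fireproof_vertices {1..n} E F}"
  let ?W = "fireproof_vertices {1..n} E F"
  let ?R = "remaining_edges {1..n} E F"
  define C where "C = (adj ?R)\<^sup>* `` {1}"
  obtain v where v: "v \<in> ?G" using False by blast
  then have one: "1 \<in> ?W" "1 \<in> {1..n}" using root_in_ancestors[OF f, of v] by auto
  \<comment> \<open>An edge at a fireproof vertex belongs to \<open>F\<close>, and an edge of
    \<open>F\<close> remains only if both its ends are fireproof.\<close>
  have CW: "C \<subseteq> ?W"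
  proof
    fix x assume "x \<in> C"
    then have "(1, x) \<in> (adj ?R)\<^sup>*" by (simp add: C_def)
    then show "x \<in> ?W"
    proof (induction rule: rtrancl_induct)
      case base
      then show ?case by (rule one)
    next
      case (step y z)
      then have yz: "{y, z} \<in> ?R" by (simp add: adj_def)
      then have "{y, z} \<in> E" by (simp add: remaining_edges_def)
      then have "{y, z} \<in> F" using step.IH by (simp add: fireproof_vertices_def)
      then show ?case using yz by (auto simp: remaining_edges_def)
    qed
  qed
  have "v \<in> C" if "v \<in> {1..n}" "ancestors f v \<subseteq> ?W" for v
    using f that
  proof (induction v rule: parent_map_induct)
    case root
    then show ?case by (simp add: C_def)
  next
    case (child k)
    then have anc: "ancestors f k = insert k (ancestors f (f k))" using ancestors_unfold[OF f] by simp
    then have W: "{k, f k} \<subseteq> ?W" using child.prems self_in_ancestors[of "f k" f] by auto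
    have "{k, f k} \<in> E" using child by (simp add: E_def parent_edges_def)
    then have "{k, f k} \<in> ?R" using W by (auto simp: remaining_edges_def)
    then have "(f k, k) \<in> adj ?R" by (simp add: adj_def insert_commute)
    moreover have "f k \<in> C" using child anc by auto
    ultimately show ?case by (auto simp: C_def intro: rtrancl_into_rtrancl)
  qed
  then have "?G \<subseteq> C" by blast
  moreover have "finite C" using CW by (rule finite_subset) (simp add: fireproof_vertices_def)
  ultimately have "card ?G \<le> card C" by (intro card_mono)
  also have "C \<in> fireproof_subtrees {1..n} E F"
    using CW one by (auto simp: fireproof_subtrees_def components_def C_def intro: quotientI)
  then have "card C \<le> largest_fireproof {1..n} E F"
    unfolding largest_fireproof_def
    by (intro Max_ge) (auto simp: fireproof_subtrees_def components_def quotient_def)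
  finally show ?thesis .
next
  case True
  show ?thesis unfolding True by simp
qed

text \<open>Markov's inequality for the number of vertices with a non-fireproof ancestor, which is
  at least \<open>n\<close> minus the size of the largest fireproof subtree.\<close>

lemma prob_largest_fireproof_fixed_tree_le:
  assumes p: "0 \<le> p" "p \<le> 1" and f: "f \<in> parent_maps n" and n: "n \<ge> 1" and \<epsilon>: "\<epsilon> > 0"
  shows "measure_pmf.prob (fire_dynamics p (parent_edges n f))
      {F. \<bar>real (largest_fireproof {1..n} (parent_edges n f) F) / real n - 1\<bar> > \<epsilon>} \<le>
    p * burn_bound n f / (\<epsilon> * real n)"
proof -
  let ?E = "parent_edges n f"
  let ?M = "fire_dynamics p ?E"
  let ?X = "{F. \<bar>real (largest_fireproof {1..n} ?E F) / real n - 1\<bar> > \<epsilon>}"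
  let ?B = "\<lambda>v. {F. \<not> ancestors f v \<subseteq> fireproof_vertices {1..n} ?E F}"
  have ind: "\<epsilon> * real n * indicator ?X F \<le> (\<Sum>v\<in>{1..n}. indicator (?B v) F)" for F
  proof (cases "F \<in> ?X")
    case True
    let ?l = "largest_fireproof {1..n} ?E F"
    let ?G = "{v \<in> {1..n}. ancestors f v \<subseteq> fireproof_vertices {1..n} ?E F}"
    \<comment> \<open>The quotient never exceeds 1, so the deviation must be downwards.\<close>
    have "?l \<le> n" using largest_fireproof_le[OF n] .
    then have "real ?l / real n \<le> 1" using n by simp
    then have "1 - real ?l / real n > \<epsilon>" using True unfolding mem_Collect_eq by linarith
    then have "\<epsilon> * real n \<le> real n - real ?l" using n by (simp add: field_simps)
    also have "\<dots> \<le> real n - real (card ?G)" using largest_fireproof_ge[OF f, of F] by simp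
    also have "\<dots> = real (card ({1..n} - ?G))"
    proof -
      have "?G \<subseteq> {1..n}" by blast
      then have "card ?G \<le> n" "card ({1..n} - ?G) = n - card ?G"
        using card_mono[of "{1..n}" ?G] by (simp_all add: card_Diff_subset finite_subset)
      then show ?thesis by (simp only: of_nat_diff)
    qed
    also have "{1..n} - ?G = {v \<in> {1..n}. F \<in> ?B v}" by auto
    also have "real (card \<dots>) = (\<Sum>v\<in>{1..n}. indicator (?B v) F)"
      by (simp add: indicator_def Int_def)
    finally show ?thesis using True by simp
  qed (simp add: sum_nonneg)
  have int: "integrable ?M (indicat_real Y)" for Y
    by (rule measure_pmf.integrable_const_bound[where B = 1]) auto
  have "\<epsilon> * real n * measure_pmf.prob ?M ?X =
      measure_pmf.expectation ?M (\<lambda>F. \<epsilon> * real n * indicator ?X F)"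
    by simp
  also have "\<dots> \<le> measure_pmf.expectation ?M (\<lambda>F. \<Sum>v\<in>{1..n}. indicator (?B v) F)"
    by (rule integral_mono[OF integrable_mult_right[OF int] Bochner_Integration.integrable_sum ind])
      (rule int)
  also have "\<dots> = (\<Sum>v\<in>{1..n}. measure_pmf.prob ?M (?B v))"
    by (subst Bochner_Integration.integral_sum) (auto intro: int)
  also have "\<dots> \<le> (\<Sum>v\<in>{1..n}. p * (\<Sum>w\<in>{1..n}.
      1 / max 1 (real (card (ancestors f w - ancestors f v)))))"
    by (intro sum_mono prob_ancestors_burnt_le p f)
  also have "\<dots> = p * burn_bound n f"
    by (simp add: burn_bound_def sum_distrib_left)
  finally show ?thesis using n \<epsilon> by (simp add: field_simps)
qed

subsection \<open>Recursive trees as parent maps\<close>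

text \<open>When a walk returns to a vertex of the path built so far, the path is cut back to that
  vertex.\<close>

lemma reachable_imp_path:
  assumes E: "E \<subseteq> {e. e \<subseteq> V \<and> card e = 2}" and "u \<in> V" and "(u, v) \<in> (adj E)\<^sup>*"
  shows "\<exists>xs. is_path V E xs \<and> hd xs = u \<and> last xs = v"
  using assms(3)
proof (induction rule: rtrancl_induct)
  case base
  show ?case using assms(2) by (intro exI[of _ "[u]"]) (simp add: is_path_def)
next
  case (step y z)
  then obtain xs where xs: "is_path V E xs" "hd xs = u" "last xs = y" by blast
  have yz: "{y, z} \<in> E" using step.hyps by (simp add: adj_def)
  then have z: "z \<in> V" using E by auto
  show ?case
  proof (cases "z \<in> set xs")
    case True
    then obtain as bs where "xs = as @ z # bs" by (meson split_list)
    then have "is_path V E (as @ [z]) \<and> hd (as @ [z]) = u \<and> last (as @ [z]) = z"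
      using xs by (auto simp: is_path_def successively_append_iff hd_append)
    then show ?thesis by blast
  next
    case False
    then have "is_path V E (xs @ [z]) \<and> hd (xs @ [z]) = u \<and> last (xs @ [z]) = z"
      using xs yz z by (auto simp: is_path_def successively_append_iff)
    then show ?thesis by blast
  qed
qed

text \<open>The parent is the only smaller neighbour of a vertex. Acyclicity, monotonicity of paths
  and injectivity of the encoding rest on this.\<close>

lemma parent_edge_iff:
  assumes f: "f \<in> parent_maps n" and "x < y"
  shows "{x, y} \<in> parent_edges n f \<longleftrightarrow> y \<in> {2..n} \<and> x = f y"
proof
  assume "{x, y} \<in> parent_edges n f"
  then obtain k where k: "k \<in> {2..n}" "{x, y} = {k, f k}" by (auto simp: parent_edges_def)
  then have "f k < k" using parent_maps_bounds[OF f, of k] by simp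
  then show "y \<in> {2..n} \<and> x = f y" using k assms(2) by (auto simp: doubleton_eq_iff)
qed (auto simp: parent_edges_def insert_commute)

lemma parent_edges_connected:
  assumes f: "f \<in> parent_maps n" and uv: "u \<in> {1..n}" "v \<in> {1..n}"
  shows "(u, v) \<in> (adj (parent_edges n f))\<^sup>*"
proof -
  let ?A = "adj (parent_edges n f)"
  have root: "(v, 1) \<in> ?A\<^sup>*" if "v \<in> {1..n}" for v
    using f that
  proof (induction v rule: parent_map_induct)
    case (child k)
    then have "(k, f k) \<in> ?A" by (simp add: adj_def parent_edges_def)
    then show ?case using child by (meson converse_rtrancl_into_rtrancl)
  qed simp
  have "sym (?A\<^sup>*)"
    by (intro sym_rtrancl) (auto simp: sym_def adj_def insert_commute)
  then have "(1, v) \<in> ?A\<^sup>*" using root[OF uv(2)] by (meson symD)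
  with root[OF uv(1)] show ?thesis by (rule rtrancl_trans)
qed

text \<open>The largest vertex of a cycle would have two smaller neighbours.\<close>

lemma parent_edges_acyclic:
  assumes f: "f \<in> parent_maps n"
  shows "\<not> is_cycle {1..n} (parent_edges n f) xs"
proof
  let ?E = "parent_edges n f"
  let ?L = "length xs"
  assume c: "is_cycle {1..n} ?E xs"
  then have d: "distinct xs" "?L \<ge> 3" "xs \<noteq> []" by (auto simp: is_cycle_def is_path_def)
  have suc: "{xs ! i, xs ! Suc i} \<in> ?E" if "Suc i < ?L" for i
    using c that by (auto simp: is_cycle_def is_path_def intro: successively_nth)
  have wrap: "{xs ! (?L - 1), xs ! 0} \<in> ?E"
    using c d by (auto simp: is_cycle_def hd_conv_nth last_conv_nth)
  obtain i where i: "i < ?L" "xs ! i = Max (set xs)"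
    using d(3) by (metis Max_in List.finite_set in_set_conv_nth set_empty)
  \<comment> \<open>\<open>a\<close> and \<open>b\<close> are the positions cyclically next to the
    maximum; they differ because a cycle has at least three vertices.\<close>
  define a where "a = (if Suc i = ?L then 0 else Suc i)"
  define b where "b = (if i = 0 then ?L - 1 else i - 1)"
  have ab: "a < ?L" "b < ?L" "a \<noteq> b" "a \<noteq> i" "b \<noteq> i"
    using i(1) d(2) by (auto simp: a_def b_def split: if_splits)
  have Ea: "{xs ! a, xs ! i} \<in> ?E"
  proof (cases "Suc i = ?L")
    case True
    then have "i = ?L - 1" by simp
    then show ?thesis using wrap True by (simp add: a_def insert_commute)
  next
    case False
    then show ?thesis using suc[of i] i(1) by (simp add: a_def insert_commute)
  qed
  have Eb: "{xs ! b, xs ! i} \<in> ?E"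
    using suc[of "i - 1"] wrap i(1) by (cases i) (simp_all add: b_def)
  have less: "xs ! j < xs ! i" if "j < ?L" "j \<noteq> i" for j
  proof -
    have "xs ! j \<le> xs ! i" unfolding i(2) using that by (intro Max_ge) auto
    moreover have "xs ! j \<noteq> xs ! i" using d(1) that i(1) by (simp add: nth_eq_iff_index_eq)
    ultimately show ?thesis by simp
  qed
  have "xs ! a = xs ! b"
    using Ea Eb parent_edge_iff[OF f less[OF ab(1,4)]] parent_edge_iff[OF f less[OF ab(2,5)]] by simp
  then show False using d(1) ab by (simp add: nth_eq_iff_index_eq)
qed

text \<open>After an increasing step, the only smaller neighbour of the current vertex is the one
  just left, to which a path cannot return. The first step increases because it leaves the smallest
  label.\<close>

lemma parent_edges_path_increasing:
  assumes f: "f \<in> parent_maps n" and xs: "is_path {1..n} (parent_edges n f) xs" "hd xs = 1"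
  shows "sorted_wrt (<) xs"
proof -
  let ?E = "parent_edges n f"
  have d: "distinct xs" "xs \<noteq> []" "set xs \<subseteq> {1..n}" using xs by (auto simp: is_path_def)
  have suc: "{xs ! i, xs ! Suc i} \<in> ?E" if "Suc i < length xs" for i
    using xs that by (auto simp: is_path_def intro: successively_nth)
  have "xs ! i < xs ! Suc i" if "Suc i < length xs" for i
    using that
  proof (induction i)
    case 0
    then have "xs ! Suc 0 \<noteq> xs ! 0" using d by (subst nth_eq_iff_index_eq) auto
    moreover have "xs ! Suc 0 \<in> {1..n}" using d 0 nth_mem by blast
    ultimately show ?case using xs(2) d(2) by (auto simp: hd_conv_nth)
  next
    case (Suc i)
    then have "xs ! i < xs ! Suc i" by simp
    then have i: "xs ! i = f (xs ! Suc i)"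
      using suc[of i] Suc.prems parent_edge_iff[OF f] by simp
    have "xs ! Suc (Suc i) \<noteq> xs ! i" "xs ! Suc (Suc i) \<noteq> xs ! Suc i"
      using d(1) Suc.prems by (simp_all add: nth_eq_iff_index_eq)
    moreover have "\<not> xs ! Suc (Suc i) < xs ! Suc i"
    proof
      assume less: "xs ! Suc (Suc i) < xs ! Suc i"
      have "{xs ! Suc (Suc i), xs ! Suc i} \<in> ?E"
        using suc[OF Suc.prems] by (simp add: insert_commute)
      then show False using parent_edge_iff[OF f less] i calculation by simp
    qed
    ultimately show ?case by simp
  qed
  then have "successively (<) xs" by (simp add: successively_conv_nth)
  then show ?thesis by (simp add: successively_conv_sorted_wrt)
qed

lemma parent_edges_recursive:
  assumes f: "f \<in> parent_maps n"
  shows "parent_edges n f \<in> recursive_trees n"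
  unfolding recursive_trees_def is_tree_def is_branch_def
  using parent_edges_subset[OF f] parent_edges_connected[OF f] parent_edges_acyclic[OF f]
    parent_edges_path_increasing[OF f] by blast

text \<open>Monotonicity is given along branches, so the path from the root to \<open>k\<close> is
  prolonged to a longest one, which ends in a leaf. The vertex before \<open>k\<close> on it is the
  required neighbour.\<close>

lemma smaller_neighbour_if_recursive:
  assumes E: "E \<in> recursive_trees n" and k: "k \<in> {2..n}"
  shows "\<exists>j. 1 \<le> j \<and> j < k \<and> {k, j} \<in> E"
proof -
  let ?V = "{1..n}"
  have sub: "E \<subseteq> {e. e \<subseteq> ?V \<and> card e = 2}" and con: "(1, k) \<in> (adj E)\<^sup>*"
    and acyc: "\<And>xs. \<not> is_cycle ?V E xs"
    and incr: "\<And>xs. is_branch 1 ?V E xs \<Longrightarrow> sorted_wrt (<) xs"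
    using E k by (auto simp: recursive_trees_def is_tree_def)
  obtain xs where xs: "is_path ?V E xs" "hd xs = 1" "last xs = k"
    using reachable_imp_path[OF sub _ con] k by auto
  have len_le: "length ys \<le> n" if "is_path ?V E ys" for ys
    using that card_mono[of ?V "set ys"] by (auto simp: is_path_def distinct_card)
  \<comment> \<open>The paths prolonging \<open>xs\<close>; their lengths are bounded by
    \<open>n\<close>, so a longest one exists.\<close>
  define Q where "Q ys \<longleftrightarrow> is_path ?V E ys \<and> (\<exists>zs. ys = xs @ zs)" for ys
  have "Q xs" using xs by (simp add: Q_def)
  moreover have "\<forall>ys. Q ys \<longrightarrow> length ys < Suc n" using len_le by (auto simp: Q_def less_Suc_eq_le)
  ultimately obtain ys where ys: "Q ys" "\<And>zs. Q zs \<Longrightarrow> length zs \<le> length ys"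
    using ex_has_greatest_nat[of Q xs length "Suc n"] by blast
  obtain zs where zs: "ys = xs @ zs" using ys(1) by (auto simp: Q_def)
  have py: "is_path ?V E ys" using ys(1) by (simp add: Q_def)
  have xs_ne: "xs \<noteq> []" using xs(1) by (simp add: is_path_def)
  have "xs \<noteq> [1]" using xs(3) k by auto
  then obtain us j where us: "xs = us @ [j, k]"
    using xs(2,3) xs_ne by (cases xs rule: rev_cases; cases "butlast xs" rule: rev_cases) auto
  have "length ys \<ge> 2" using zs us by simp
  then obtain ws y z where ws: "ys = ws @ [y, z]"
    by (cases ys rule: rev_cases; cases "butlast ys" rule: rev_cases) auto
  have hd_ys: "hd ys = 1" using zs xs_ne xs(2) by simp
  have yz: "{y, z} \<in> E" and zV: "z \<in> ?V" and dist: "distinct ys"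
    using py ws by (auto simp: is_path_def successively_append_iff)
  have z1: "z \<noteq> 1" using hd_ys dist ws by (cases ws) auto
  \<comment> \<open>At the end \<open>z\<close> of a longest prolongation, a neighbour off the path
    would extend it, and one on the path other than \<open>y\<close> would close a cycle.\<close>
  have "e = {y, z}" if e: "e \<in> E" "z \<in> e" for e
  proof -
    have "card e = 2" "e \<subseteq> ?V" using sub e by auto
    then obtain p q where pq: "e = {p, q}" "p \<noteq> q" by (auto simp: card_2_iff)
    then have "(e = {z, p} \<and> p \<noteq> z) \<or> (e = {z, q} \<and> q \<noteq> z)" using e(2) by auto
    then obtain x where x: "e = {z, x}" "x \<noteq> z" "x \<in> ?V"
      using \<open>e \<subseteq> ?V\<close> by blast
    have "x \<in> set ys"
    proof (rule ccontr)
      assume "x \<notin> set ys"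
      then have "is_path ?V E (ys @ [x])"
        using py x e ws by (auto simp: is_path_def successively_append_iff)
      then have "Q (ys @ [x])" using zs by (simp add: Q_def)
      then show False using ys(2) by fastforce
    qed
    then obtain as bs where ab: "ys = as @ x # bs" by (meson split_list)
    have last: "last ys = z" using ws by simp
    have "x = y"
    proof (rule ccontr)
      assume "x \<noteq> y"
      \<comment> \<open>As \<open>x\<close> is neither of the last two vertices,
        \<open>x # bs\<close> is long enough for a cycle.\<close>
      have "length bs \<ge> 2"
      proof (rule ccontr)
        assume "\<not> length bs \<ge> 2"
        then have "bs = [] \<or> (\<exists>c. bs = [c])" by (cases bs; cases "tl bs") auto
        then show False using ab ws x(2) \<open>x \<noteq> y\<close> by auto
      qed
      then have "is_cycle ?V E (x # bs)"
        using py ab last e x by (auto simp: is_cycle_def is_path_def successively_append_iff)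
      then show False using acyc by blast
    qed
    then show ?thesis using x by auto
  qed
  then have "{e \<in> E. z \<in> e} = {{y, z}}" using yz by blast
  then have "is_leaf 1 ?V E z" using zV z1 by (simp add: is_leaf_def)
  moreover have "last ys = z" using ws by simp
  ultimately have "is_branch 1 ?V E ys" using py hd_ys unfolding is_branch_def by metis
  then have "sorted_wrt (<) ys" by (rule incr)
  then have "j < k" using zs us by (simp add: sorted_wrt_append)
  moreover have "{k, j} \<in> E" "1 \<le> j"
    using xs(1) unfolding us is_path_def successively_append_iff
    by (simp_all add: insert_commute)
  ultimately show ?thesis by blast
qed

text \<open>Choosing a smaller neighbour of every vertex other than \<open>1\<close> yields a
  spanning tree inside \<open>E\<close>; any further edge of \<open>E\<close> would close a
  cycle.\<close>

lemma recursive_trees_eq: "recursive_trees n = parent_edges n ` parent_maps n"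
proof (intro equalityI subsetI)
  fix E assume E: "E \<in> recursive_trees n"
  let ?V = "{1..n}"
  have sub: "E \<subseteq> {e. e \<subseteq> ?V \<and> card e = 2}" and acyc: "\<And>xs. \<not> is_cycle ?V E xs"
    using E by (auto simp: recursive_trees_def is_tree_def)
  obtain g where g: "\<And>k. k \<in> {2..n} \<Longrightarrow> 1 \<le> g k \<and> g k < k \<and> {k, g k} \<in> E"
    using smaller_neighbour_if_recursive[OF E] by metis
  define f where "f = restrict g {2..n}"
  have f: "f \<in> parent_maps n" using g by (auto simp: parent_maps_def f_def)
  have fE: "parent_edges n f \<subseteq> E" using g by (auto simp: parent_edges_def f_def)
  have "E \<subseteq> parent_edges n f"
  proof
    fix e assume e: "e \<in> E"
    then have "card e = 2" "e \<subseteq> ?V" using sub by auto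
    then obtain a b where ab: "e = {a, b}" "a \<noteq> b" "a \<in> ?V" "b \<in> ?V"
      unfolding card_2_iff by blast
    obtain xs where xs: "is_path ?V (parent_edges n f) xs" "hd xs = a" "last xs = b"
      using reachable_imp_path[OF parent_edges_subset[OF f] ab(3) parent_edges_connected[OF f ab(3,4)]]
      by blast
    have "is_path ?V E xs"
      using xs(1) fE by (auto simp: is_path_def elim: successively_mono)
    \<comment> \<open>Otherwise \<open>e\<close> would close \<open>xs\<close> to a cycle in
      \<open>E\<close>.\<close>
    then have "length xs < 3"
      using acyc[of xs] xs(2,3) e ab(1) by (auto simp: is_cycle_def insert_commute)
    moreover have "xs \<noteq> []" "length xs \<noteq> 1"
      using xs ab(2) by (auto simp: is_path_def length_Suc_conv)
    ultimately have "length xs = 2" by (cases "length xs") auto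
    then have "xs = [a, b]"
      using xs(2,3) by (auto simp: numeral_2_eq_2 length_Suc_conv)
    then show "e \<in> parent_edges n f" using xs(1) ab(1) by (simp add: is_path_def)
  qed
  then show "E \<in> parent_edges n ` parent_maps n" using fE f by blast
qed (auto intro: parent_edges_recursive)

text \<open>With \<open>recursive_trees_eq\<close>, a uniform recursive tree is the edge set of a
  uniform parent map.\<close>

lemma inj_on_parent_edges: "inj_on (parent_edges n) (parent_maps n)"
proof (rule inj_onI)
  fix f g assume fg: "f \<in> parent_maps n" "g \<in> parent_maps n" "parent_edges n f = parent_edges n g"
  have "f k = g k" if k: "k \<in> {2..n}" for k
  proof -
    have less: "f k < k" using parent_maps_bounds[OF fg(1), of k] k by simp
    then have "{f k, k} \<in> parent_edges n g" using parent_edge_iff[OF fg(1) less] k fg(3) by simp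
    then show ?thesis using parent_edge_iff[OF fg(2) less] by simp
  qed
  with fg(1,2) show "f = g" unfolding parent_maps_def by (rule PiE_ext)
qed

subsection \<open>Averaging over recursive trees\<close>

text \<open>Growth by one leaf: vertex \<open>Suc n\<close> chooses its parent \<open>u\<close>
  freely among the older vertices.\<close>

lemma sum_parent_maps_Suc:
  assumes n: "n \<ge> 1"
  shows "(\<Sum>g\<in>parent_maps (Suc n). h g) = (\<Sum>f\<in>parent_maps n. \<Sum>u\<in>{1..n}. h (f(Suc n := u)))"
proof -
  have ins: "{2..Suc n} = insert (Suc n) {2..n}" using n by auto
  have "parent_maps (Suc n) = (\<lambda>(u, f). f(Suc n := u)) ` ({1..<Suc n} \<times> parent_maps n)"
    unfolding parent_maps_def ins by (rule PiE_insert_eq)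
  moreover have "inj_on (\<lambda>(u, f). f(Suc n := u)) ({1..<Suc n} \<times> parent_maps n)"
    unfolding parent_maps_def using inj_combinator[of "Suc n" "{2..n}" "\<lambda>k. {1..<k}"] by simp
  ultimately have "(\<Sum>g\<in>parent_maps (Suc n). h g) =
      (\<Sum>(u, f)\<in>{1..n} \<times> parent_maps n. h (f(Suc n := u)))"
    by (simp add: sum.reindex case_prod_unfold atLeastLessThanSuc_atLeastAtMost)
  also have "\<dots> = (\<Sum>u\<in>{1..n}. \<Sum>f\<in>parent_maps n. h (f(Suc n := u)))"
    by (rule sum.cartesian_product[symmetric])
  finally show ?thesis by (simp only: sum.swap[of _ "{1..n}"])
qed

lemma card_parent_maps_Suc:
  assumes "n \<ge> 1"
  shows "real (card (parent_maps (Suc n))) = real n * real (card (parent_maps n))"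
  using sum_parent_maps_Suc[OF assms, of "\<lambda>_. 1 :: real"] by simp

text \<open>An exponential moment of the number of ancestors of \<open>w\<close> that are not shared
  with \<open>v\<close>: it controls how many pairs have few of them. The base \<open>1/2\<close>
  leads to growth of order \<open>n powr (3/2)\<close>, below the number \<open>n^2\<close> of
  pairs.\<close>

definition half_power_sum :: "nat \<Rightarrow> (nat \<Rightarrow> nat) \<Rightarrow> real" where
  "half_power_sum n f =
     (\<Sum>v\<in>{1..n}. \<Sum>w\<in>{1..n}. (1/2) ^ card (ancestors f w - ancestors f v))"

text \<open>The new leaf is an ancestor of no older vertex. As \<open>v\<close> it acts like
  \<open>u\<close>; as \<open>w\<close> it has one more unshared ancestor than \<open>u\<close>,
  namely itself, whence the division by 2. The summand 1 is the pair of the leaf with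
  itself.\<close>

lemma half_power_sum_update:
  assumes f: "f \<in> parent_maps n" and u: "u \<in> {1..n}"
  shows "half_power_sum (Suc n) (f(Suc n := u)) = half_power_sum n f + 1 +
    (\<Sum>w\<in>{1..n}. (1/2) ^ card (ancestors f w - ancestors f u)) +
    (\<Sum>v\<in>{1..n}. (1/2) ^ card (ancestors f u - ancestors f v)) / 2"
proof -
  let ?g = "f(Suc n := u)"
  let ?x = "\<lambda>A. (1/2 :: real) ^ card (A :: nat set)"
  have old: "ancestors ?g k = ancestors f k" if "k \<in> {1..n}" for k
    using that by (intro ancestors_cong) auto
  have new: "ancestors ?g (Suc n) = insert (Suc n) (ancestors f u)"
    using u old[OF u] by (subst ancestors.simps) simp
  have notin: "Suc n \<notin> ancestors f k" if "k \<in> {1..n}" for k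
    using ancestors_subset[OF f that] that by auto
  have below: "?x (ancestors ?g w - ancestors ?g (Suc n)) = ?x (ancestors f w - ancestors f u)"
    if w: "w \<in> {1..n}" for w
    using notin[OF w] unfolding new old[OF w] by simp
  have above: "?x (ancestors ?g (Suc n) - ancestors ?g v) = ?x (ancestors f u - ancestors f v) / 2"
    if v: "v \<in> {1..n}" for v
    using notin[OF v] notin[OF u] finite_ancestors[OF f u] unfolding new old[OF v]
    by (simp add: insert_Diff_if)
  have split: "(\<Sum>v\<in>{1..Suc n}. F v) = (\<Sum>v\<in>{1..n}. F v) + F (Suc n)" for F :: "nat \<Rightarrow> real"
    by simp
  have "half_power_sum (Suc n) ?g =
      (\<Sum>v\<in>{1..n}. (\<Sum>w\<in>{1..n}. ?x (ancestors ?g w - ancestors ?g v)) +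
        ?x (ancestors ?g (Suc n) - ancestors ?g v)) +
      ((\<Sum>w\<in>{1..n}. ?x (ancestors ?g w - ancestors ?g (Suc n))) +
        ?x (ancestors ?g (Suc n) - ancestors ?g (Suc n)))"
    unfolding half_power_sum_def split ..
  also have "(\<Sum>v\<in>{1..n}. (\<Sum>w\<in>{1..n}. ?x (ancestors ?g w - ancestors ?g v)) +
        ?x (ancestors ?g (Suc n) - ancestors ?g v)) =
      (\<Sum>v\<in>{1..n}. (\<Sum>w\<in>{1..n}. ?x (ancestors f w - ancestors f v)) +
        ?x (ancestors f u - ancestors f v) / 2)"
    by (intro sum.cong arg_cong2[where f = "(+)"] refl above) (simp add: old)
  also have "(\<Sum>w\<in>{1..n}. ?x (ancestors ?g w - ancestors ?g (Suc n))) =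
      (\<Sum>w\<in>{1..n}. ?x (ancestors f w - ancestors f u))"
    by (intro sum.cong refl below)
  finally show ?thesis
    by (simp only: sum.distrib half_power_sum_def sum_divide_distrib Diff_cancel card.empty
        power_0 add_ac)
qed

text \<open>Summed over \<open>u\<close>, each one-sided sum becomes
  \<open>half_power_sum n f\<close>, the second one halved; with the \<open>n\<close> copies of the
  old pairs this makes \<open>n + 3/2\<close>.\<close>

lemma sum_half_power_sum_Suc:
  assumes n: "n \<ge> 1"
  shows "(\<Sum>g\<in>parent_maps (Suc n). half_power_sum (Suc n) g) =
    (real n + 3/2) * (\<Sum>f\<in>parent_maps n. half_power_sum n f) + real n * real (card (parent_maps n))"
proof -
  have "(\<Sum>u\<in>{1..n}. half_power_sum (Suc n) (f(Suc n := u))) =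
      (real n + 3/2) * half_power_sum n f + real n" if f: "f \<in> parent_maps n" for f
  proof -
    let ?x = "\<lambda>A. (1/2 :: real) ^ card (A :: nat set)"
    have "(\<Sum>u\<in>{1..n}. half_power_sum (Suc n) (f(Suc n := u))) =
        (\<Sum>u\<in>{1..n}. half_power_sum n f + 1 +
          (\<Sum>w\<in>{1..n}. ?x (ancestors f w - ancestors f u)) +
          (\<Sum>v\<in>{1..n}. ?x (ancestors f u - ancestors f v)) / 2)"
      by (intro sum.cong refl half_power_sum_update f)
    also have "\<dots> = real n * (half_power_sum n f + 1) + half_power_sum n f +
        (\<Sum>u\<in>{1..n}. \<Sum>v\<in>{1..n}. ?x (ancestors f u - ancestors f v)) / 2"
      by (simp only: sum.distrib half_power_sum_def sum_divide_distrib[symmetric] sum_constant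
          card_atLeastAtMost) (simp add: algebra_simps)
    also have "(\<Sum>u\<in>{1..n}. \<Sum>v\<in>{1..n}. ?x (ancestors f u - ancestors f v)) = half_power_sum n f"
      unfolding half_power_sum_def by (rule sum.swap)
    also have "real n * (half_power_sum n f + 1) + half_power_sum n f + half_power_sum n f / 2 =
        (real n + 3/2) * half_power_sum n f + real n"
      by (simp add: algebra_simps)
    finally show ?thesis .
  qed
  then show ?thesis
    unfolding sum_parent_maps_Suc[OF n]
    by (simp add: sum.distrib sum_distrib_left[symmetric] sum_distrib_right[symmetric]
        mult.commute[of "real n + 3/2"] mult.commute[of "real (card _)"])
qed

text \<open>After squaring, the sides differ by \<open>3 * x / 4 + 1\<close>. This lets
  \<open>n * sqrt n\<close> dominate the recursion above.\<close>

lemma add_three_halves_sqrt_le: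
  assumes "x \<ge> 0"
  shows "(x + 3/2) * sqrt x \<le> (x + 1) * sqrt (x + 1)"
proof (rule power2_le_imp_le)
  have "0 \<le> x * 3 / 4 + 1" using assms by simp
  then have "(x + 3/2)\<^sup>2 * x \<le> (x + 1)\<^sup>2 * (x + 1)"
    by (simp add: power2_eq_square algebra_simps)
  then show "((x + 3/2) * sqrt x)\<^sup>2 \<le> ((x + 1) * sqrt (x + 1))\<^sup>2"
    using assms by (simp add: power_mult_distrib)
qed (use assms in simp)

text \<open>
  By \<open>sum_half_power_sum_Suc\<close>, the mean \<open>s\<close> of \<^const>\<open>half_power_sum\<close> over
  \<^term>\<open>parent_maps n\<close> satisfies
  \<open>s (n + 1) + 2 (n + 1) = (1 + 3 / (2 n)) (s n + 2 n)\<close>; this is why \<open>2 n\<close> is added.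
\<close>

lemma sum_half_power_sum_le:
  assumes "n \<ge> 1"
  shows "(\<Sum>f\<in>parent_maps n. half_power_sum n f) + 2 * real n * real (card (parent_maps n)) \<le>
    3 * (real n * sqrt (real n)) * real (card (parent_maps n))"
  using assms
proof (induction n rule: nat_induct_at_least)
  case base
  \<comment> \<open>The single pair contributes 1, so both sides equal 3; hence the constant
    3.\<close>
  have "parent_maps 1 = {\<lambda>_. undefined}" by (simp add: parent_maps_def)
  then show ?case by (simp add: half_power_sum_def)
next
  case (Suc n)
  let ?s = "\<Sum>f\<in>parent_maps n. half_power_sum n f"
  let ?c = "real (card (parent_maps n))"
  have "(\<Sum>f\<in>parent_maps (Suc n). half_power_sum (Suc n) f) +
      2 * real (Suc n) * real (card (parent_maps (Suc n))) =
      (real n + 3/2) * (?s + 2 * real n * ?c)"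
    unfolding sum_half_power_sum_Suc[OF Suc.hyps] card_parent_maps_Suc[OF Suc.hyps]
    by (simp add: algebra_simps)
  also have "\<dots> \<le> (real n + 3/2) * (3 * (real n * sqrt (real n)) * ?c)"
    by (intro mult_left_mono Suc.IH) simp
  also have "\<dots> = 3 * real n * ?c * ((real n + 3/2) * sqrt (real n))"
    by (simp add: mult_ac)
  also have "\<dots> \<le> 3 * real n * ?c * ((real n + 1) * sqrt (real n + 1))"
    by (intro mult_left_mono add_three_halves_sqrt_le) auto
  also have "\<dots> = 3 * (real (Suc n) * sqrt (real (Suc n))) * real (card (parent_maps (Suc n)))"
    unfolding card_parent_maps_Suc[OF Suc.hyps] by (simp add: mult_ac add.commute)
  finally show ?case .
qed

section \<open>Mean burning bound and the limit\<close>

lemma inverse_max_le: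
  fixes m :: real
  assumes "m > 0"
  shows "1 / max 1 (real d) \<le> 1 / m + 2 powr m * (1/2) ^ d"
proof (cases "m \<le> real d")
  case True
  then have "1 / max 1 (real d) \<le> 1 / m" using assms by (intro divide_left_mono) auto
  then show ?thesis by (smt (verit) powr_ge_zero mult_nonneg_nonneg zero_le_power divide_nonneg_nonneg)
next
  case False
  \<comment> \<open>Below the threshold \<open>m\<close> the second summand is at least 1; above it
    the first one suffices.\<close>
  then have "2 powr real d \<le> 2 powr m" by simp
  then have "1 \<le> 2 powr m * (1/2) ^ d"
    by (simp add: powr_realpow power_divide field_simps)
  moreover have "1 / max 1 (real d) \<le> 1" by simp
  ultimately show ?thesis using assms by (smt (verit) divide_nonneg_nonneg)
qed

text \<open>Pairs with at least \<open>m\<close> unshared ancestors cost at most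
  \<open>n^2 / m\<close> in total; the others are controlled by \<open>half_power_sum\<close>. The
  threshold stays free here.\<close>

lemma sum_burn_bound_le:
  assumes n: "n \<ge> 1" and m: "m > 0"
  shows "(\<Sum>f\<in>parent_maps n. burn_bound n f) \<le>
    real (card (parent_maps n)) * ((real n)\<^sup>2 / m + 2 powr m * (3 * (real n * sqrt (real n))))"
proof -
  let ?c = "real (card (parent_maps n))"
  have "burn_bound n f \<le> (real n)\<^sup>2 / m + 2 powr m * half_power_sum n f" for f
  proof -
    have "burn_bound n f \<le> (\<Sum>v\<in>{1..n}. \<Sum>w\<in>{1..n}.
        1 / m + 2 powr m * (1/2) ^ card (ancestors f w - ancestors f v))"
      unfolding burn_bound_def by (intro sum_mono inverse_max_le m)
    then show ?thesis
      by (simp add: half_power_sum_def sum.distrib sum_distrib_left power2_eq_square)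
  qed
  then have "(\<Sum>f\<in>parent_maps n. burn_bound n f) \<le>
      (\<Sum>f\<in>parent_maps n. (real n)\<^sup>2 / m + 2 powr m * half_power_sum n f)"
    by (intro sum_mono)
  also have "\<dots> = ?c * ((real n)\<^sup>2 / m) + 2 powr m * (\<Sum>f\<in>parent_maps n. half_power_sum n f)"
    by (simp add: sum.distrib sum_distrib_left)
  also have "(\<Sum>f\<in>parent_maps n. half_power_sum n f) \<le> 3 * (real n * sqrt (real n)) * ?c"
    using sum_half_power_sum_le[OF n] by (smt (verit) mult_nonneg_nonneg of_nat_0_le_iff)
  finally show ?thesis by (simp add: algebra_simps)
qed

text \<open>The bound for a fixed tree is linear in \<open>burn_bound\<close>, so only the mean of
  \<open>burn_bound\<close> over parent maps enters.\<close>

lemma prob_largest_fireproof_le: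
  assumes p: "0 \<le> p" "p \<le> 1" and n: "n \<ge> 1" and \<epsilon>: "\<epsilon> > 0" and m: "m > 0"
  shows "measure_pmf.prob (largest_fireproof_pmf n p) {k. \<bar>real k / real n - 1\<bar> > \<epsilon>} \<le>
    p / \<epsilon> * (real n / m + 2 powr m * (3 * sqrt (real n)))"
proof -
  let ?X = "{k. \<bar>real k / real n - 1\<bar> > \<epsilon>}"
  let ?c = "real (card (parent_maps n))"
  let ?g = "\<lambda>E. map_pmf (largest_fireproof {1..n} E) (fire_dynamics p E)"
  have c: "?c > 0" using finite_parent_maps parent_maps_nonempty by (simp add: card_gt_0_iff)
  have "largest_fireproof_pmf n p = bind_pmf (pmf_of_set (recursive_trees n)) ?g"
    by (simp add: largest_fireproof_pmf_def map_pmf_def)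
  also have "measure_pmf.prob \<dots> ?X =
      (\<Sum>E\<in>recursive_trees n. measure_pmf.prob (?g E) ?X) / real (card (recursive_trees n))"
    using finite_parent_maps parent_maps_nonempty
    by (intro prob_bind_pmf_of_set) (auto simp: recursive_trees_eq)
  also have "\<dots> = (\<Sum>f\<in>parent_maps n. measure_pmf.prob (?g (parent_edges n f)) ?X) / ?c"
    by (simp add: recursive_trees_eq sum.reindex card_image inj_on_parent_edges)
  also have "\<dots> \<le> (\<Sum>f\<in>parent_maps n. p * burn_bound n f / (\<epsilon> * real n)) / ?c"
    using prob_largest_fireproof_fixed_tree_le[OF p _ n \<epsilon>]
    by (intro divide_right_mono sum_mono) (simp_all add: vimage_def)
  also have "\<dots> = p / (\<epsilon> * real n) * ((\<Sum>f\<in>parent_maps n. burn_bound n f) / ?c)"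
    by (simp add: sum_distrib_left sum_divide_distrib)
  also have "\<dots> \<le> p / (\<epsilon> * real n) *
      ((real n)\<^sup>2 / m + 2 powr m * (3 * (real n * sqrt (real n))))"
    using sum_burn_bound_le[OF n m] c p \<epsilon>
    by (intro mult_left_mono) (auto simp: field_simps)
  also have "\<dots> = p / \<epsilon> * (real n / m + 2 powr m * (3 * sqrt (real n)))"
    using n \<epsilon> m by (simp add: field_simps power2_eq_square)
  finally show ?thesis .
qed

theorem corollary1:
  fixes p :: "nat \<Rightarrow> real"
  assumes "\<And>n. n \<ge> 1 \<Longrightarrow> 0 \<le> p n \<and> p n \<le> 1"
    and "(\<lambda>n. real n * p n / ln (real n)) \<longlonglongrightarrow> 0"
  shows "\<forall>\<epsilon>>0. (\<lambda>n. measure_pmf.prob (largest_fireproof_pmf n (p n))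
                        {k. \<bar>real k / real n - 1\<bar> > \<epsilon>}) \<longlonglongrightarrow> 0"
proof (intro allI impI)
  fix \<epsilon> :: real assume \<epsilon>: "\<epsilon> > 0"
  let ?P = "\<lambda>n. measure_pmf.prob (largest_fireproof_pmf n (p n)) {k. \<bar>real k / real n - 1\<bar> > \<epsilon>}"
  \<comment> \<open>The choice is \<open>m = ln n / 4\<close>: as
    \<open>2 powr m \<le> exp m\<close>, the second term is at most \<open>3 * n powr (3/4)\<close>,
    negligible against \<open>n / ln n\<close>. \<open>?r\<close> is what remains after factoring
    out \<open>n / ln n\<close>.\<close>
  let ?r = "\<lambda>n. 4 + ln (real n) / real n * (exp (ln (real n) / 4) * (3 * sqrt (real n)))"
  have bound: "?P n \<le> real n * p n / ln (real n) * (?r n / \<epsilon>)" if n: "n \<ge> 2" for n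
  proof -
    have ln: "ln (real n) > 0" using n by simp
    have pn: "0 \<le> p n" "p n \<le> 1" using assms(1)[of n] n by auto
    have "ln 2 * (ln (real n) / 4) \<le> 1 * (ln (real n) / 4)"
      using ln ln_2_less_1 by (intro mult_right_mono) auto
    then have powr: "2 powr (ln (real n) / 4) \<le> exp (ln (real n) / 4)"
      by (simp add: powr_def mult.commute)
    have "?P n \<le> p n / \<epsilon> *
        (real n / (ln (real n) / 4) + 2 powr (ln (real n) / 4) * (3 * sqrt (real n)))"
      using n ln by (intro prob_largest_fireproof_le pn \<epsilon>) auto
    also have "\<dots> \<le> p n / \<epsilon> *
        (real n / (ln (real n) / 4) + exp (ln (real n) / 4) * (3 * sqrt (real n)))"
      using pn \<epsilon> powr by (intro mult_left_mono add_left_mono mult_right_mono) auto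
    also have "\<dots> = real n * p n / ln (real n) * (?r n / \<epsilon>)"
      using n ln \<epsilon> by (simp add: field_simps)
    finally show ?thesis .
  qed
  \<comment> \<open>The second summand is of order \<open>ln n / n powr (1/4)\<close>.\<close>
  have "?r \<longlonglongrightarrow> 4" by real_asymp
  then have "(\<lambda>n. real n * p n / ln (real n) * (?r n / \<epsilon>)) \<longlonglongrightarrow> 0 * (4 / \<epsilon>)"
    using \<epsilon> by (intro tendsto_mult[OF assms(2)] tendsto_divide tendsto_const) auto
  then have lim: "(\<lambda>n. real n * p n / ln (real n) * (?r n / \<epsilon>)) \<longlonglongrightarrow> 0" by simp
  show "?P \<longlonglongrightarrow> 0"
  proof (rule tendsto_sandwich[OF _ _ tendsto_const lim])
    show "\<forall>\<^sub>F n in sequentially. ?P n \<le> real n * p n / ln (real n) * (?r n / \<epsilon>)"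
      using eventually_ge_at_top[of 2] by eventually_elim (rule bound)
  qed simp
qed

end
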